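(* Every suborderable quasi-king space is compact.
   Context: All spaces are Hausdorff topological spaces. For a set $X$, let $\mathscr{F}_2(X)=\{S\subset X: 1\le |S|\le 2\}$. A weak selection for $X$ is a map $\sigma:\mathscr{F}_2(X)\to X$ with $\sigma(S)\in S$ for every $S\in\mathscr{F}_2(X)$. It generates the (total, antisymmetric, not necessarily transitive) relation $x\leq_\sigma y$ iff $\sigma(\{x,y\})=x$; write $x<_\sigma y$ if $x\leq_\sigma y$ and $x\neq y$. The selection topology $\mathscr{T}_\sigma$ on $X$ is the topology with subbase consisting of all sets $\{y\in X: y<_\sigma x\}$ and $\{y\in X: x<_\sigma y\}$, $x\in X$. A weak selection $\sigma$ for a space $(X,\mathscr{T})$ is separately continuous if $\mathscr{T}_\sigma\subset\mathscr{T}$. A point $q\in X$ is a quasi $\sigma$-king if for each $x\in X$ there are finitely many points $y_1,\dots,y_n\in X$ with $x\leq_\sigma y_1\leq_\sigma\dots\leq_\sigma y_n\leq_\sigma q$. A space $X$ is quasi-king if it has a separately continuous weak selection, and every separately continuous weak selection $\sigma$ for $X$ has a quasi $\sigma$-king. A space is orderable if its topology is the open interval topology of some linear order; it is suborderable if it is (homeomorphic to) a subspace of an orderable space. Equivalently (by a result of Čech), $(X,\mathscr{T})$ is suborderable iff it admits a linear order $\leq$ whose open interval topology is contained in $\mathscr{T}$ and such that $\mathscr{T}$ has a base of $\leq$-convex sets. *)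

theory Defs
  imports "HOL-Analysis.Analysis"
begin

definition F2 :: "'a set \<Rightarrow> 'a set set" where
  "F2 A = {S. S \<subseteq> A \<and> 1 \<le> card S \<and> card S \<le> 2}"

text \<open>Only the values of \<open>\<sigma>\<close> on \<open>F2 A\<close> matter; elsewhere it is unconstrained.\<close>

definition weak_selection :: "'a set \<Rightarrow> ('a set \<Rightarrow> 'a) \<Rightarrow> bool" where
  "weak_selection A \<sigma> \<longleftrightarrow> (\<forall>S\<in>F2 A. \<sigma> S \<in> S)"

definition sel_le :: "('a set \<Rightarrow> 'a) \<Rightarrow> 'a \<Rightarrow> 'a \<Rightarrow> bool" where
  "sel_le \<sigma> x y \<longleftrightarrow> \<sigma> {x, y} = x"

definition sel_less :: "('a set \<Rightarrow> 'a) \<Rightarrow> 'a \<Rightarrow> 'a \<Rightarrow> bool" where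
  "sel_less \<sigma> x y \<longleftrightarrow> sel_le \<sigma> x y \<and> x \<noteq> y"

definition open_rays :: "'a set \<Rightarrow> ('a \<Rightarrow> 'a \<Rightarrow> bool) \<Rightarrow> 'a set set" where
  "open_rays A lt = (\<Union>x\<in>A. {{y\<in>A. lt y x}, {y\<in>A. lt x y}})"

text \<open>The topology on \<open>A\<close> with the open rays as subbase. Thanks to \<open>relative_to A\<close> the
  empty intersection is \<open>A\<close>, so the underlying set is \<open>A\<close> even when \<open>A\<close> is a singleton.\<close>

definition ray_topology :: "'a set \<Rightarrow> ('a \<Rightarrow> 'a \<Rightarrow> bool) \<Rightarrow> 'a topology" where
  "ray_topology A lt =
     topology (arbitrary union_of
       (finite intersection_of (\<lambda>S. S \<in> open_rays A lt) relative_to A))"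

definition selection_topology :: "'a set \<Rightarrow> ('a set \<Rightarrow> 'a) \<Rightarrow> 'a topology" where
  "selection_topology A \<sigma> = ray_topology A (sel_less \<sigma>)"

definition separately_continuous_selection :: "'a topology \<Rightarrow> ('a set \<Rightarrow> 'a) \<Rightarrow> bool" where
  "separately_continuous_selection X \<sigma> \<longleftrightarrow>
     weak_selection (topspace X) \<sigma> \<and>
     (\<forall>U. openin (selection_topology (topspace X) \<sigma>) U \<longrightarrow> openin X U)"

definition quasi_sel_king :: "'a set \<Rightarrow> ('a set \<Rightarrow> 'a) \<Rightarrow> 'a \<Rightarrow> bool" where
  "quasi_sel_king A \<sigma> q \<longleftrightarrow>
     q \<in> A \<and>
     (\<forall>x\<in>A. \<exists>ys. ys \<noteq> [] \<and> set ys \<subseteq> A \<and> successively (sel_le \<sigma>) (x # ys @ [q]))"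

definition quasi_king_space :: "'a topology \<Rightarrow> bool" where
  "quasi_king_space X \<longleftrightarrow>
     (\<exists>\<sigma>. separately_continuous_selection X \<sigma>) \<and>
     (\<forall>\<sigma>. separately_continuous_selection X \<sigma> \<longrightarrow> (\<exists>q. quasi_sel_king (topspace X) \<sigma> q))"

definition open_interval_topology :: "'a set \<Rightarrow> ('a \<times> 'a) set \<Rightarrow> 'a topology" where
  "open_interval_topology A r = ray_topology A (\<lambda>x y. (x, y) \<in> r \<and> x \<noteq> y)"

definition orderable_space :: "'a topology \<Rightarrow> bool" where
  "orderable_space Y \<longleftrightarrow>
     (\<exists>r. linear_order_on (topspace Y) r \<and> Y = open_interval_topology (topspace Y) r)"

text \<open>HOL cannot quantify existentially over the type carrying the ambient orderable space, so
  that type is a parameter. A theorem assuming \<open>suborderable_space TYPE('b) X\<close> with \<open>'b\<close> a type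
  variable covers every possible ambient space.\<close>

definition suborderable_space :: "'b itself \<Rightarrow> 'a topology \<Rightarrow> bool" where
  "suborderable_space _ X \<longleftrightarrow>
     (\<exists>(Y :: 'b topology) S. orderable_space Y \<and> S \<subseteq> topspace Y \<and>
        X homeomorphic_space subtopology Y S)"

end

theory Submission
  imports Defs
begin

text \<open>
  The theorem is proved by contraposition: a suborderable space that fails to be compact carries
  a separately continuous weak selection without a quasi-king.

  A suborderable space has a linear order whose open rays are open and whose order-convex open
  sets form a base (\<open>suborderable_imp_go_order\<close>). With such an order, compactness can only fail
  at a gap: there is a nonempty clopen initial segment without a last point, or a nonempty clopen
  final segment without a first point (\<open>compact_if_no_gaps\<close>). Reversing the order exchanges the
  two cases, so let \<open>A\<close> be a nonempty clopen initial segment without a last point. Move the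
  complement of \<open>A\<close> below \<open>A\<close>, keeping the order inside both pieces
  (\<open>quasi_king_clopen_has_last\<close>). Since both pieces are clopen, the open rays of the new linear
  order are still open, so choosing the smaller of two points is a separately continuous weak
  selection (\<open>min_selection_separately_continuous\<close>). As the new order is transitive, a quasi-king
  would be its last point, but a last point of the new order would be a last point of \<open>A\<close>, and
  there is none.
\<close>

section \<open>Topologies generated by open rays\<close>

definition strict_linear_on :: "'a set \<Rightarrow> ('a \<Rightarrow> 'a \<Rightarrow> bool) \<Rightarrow> bool" where
  "strict_linear_on A lt \<longleftrightarrow>
     (\<forall>x\<in>A. \<not> lt x x) \<and>
     (\<forall>x\<in>A. \<forall>y\<in>A. \<forall>z\<in>A. lt x y \<longrightarrow> lt y z \<longrightarrow> lt x z) \<and>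
     (\<forall>x\<in>A. \<forall>y\<in>A. x \<noteq> y \<longrightarrow> lt x y \<or> lt y x)"

lemma strict_linear_on_irrefl:
  assumes "strict_linear_on A lt" "x \<in> A"
  shows "\<not> lt x x"
  using assms(1)[unfolded strict_linear_on_def, THEN conjunct1] assms(2) by (rule bspec)

lemma strict_linear_on_trans:
  assumes "strict_linear_on A lt" "x \<in> A" "y \<in> A" "z \<in> A" "lt x y" "lt y z"
  shows "lt x z"
  by (rule assms(1)[unfolded strict_linear_on_def, THEN conjunct2, THEN conjunct1, rule_format,
        OF assms(2-)])

lemma strict_linear_on_total:
  assumes "strict_linear_on A lt" "x \<in> A" "y \<in> A" "x \<noteq> y"
  shows "lt x y \<or> lt y x"
  by (rule assms(1)[unfolded strict_linear_on_def, THEN conjunct2, THEN conjunct2, rule_format,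
        OF assms(2-)])

lemma strict_linear_on_converse:
  assumes "strict_linear_on A lt"
  shows "strict_linear_on A (\<lambda>x y. lt y x)"
  unfolding strict_linear_on_def
proof (intro conjI ballI impI)
  fix x y z assume "x \<in> A" "y \<in> A" "z \<in> A" "lt y x" "lt z y"
  then show "lt z x" using strict_linear_on_trans[OF assms, of z y x] by simp
next
  fix x y assume "x \<in> A" "y \<in> A" "x \<noteq> y"
  then show "lt y x \<or> lt x y" using strict_linear_on_total[OF assms, of y x] by simp
qed (use strict_linear_on_irrefl[OF assms] in simp)

definition order_convex_in :: "'a set \<Rightarrow> ('a \<Rightarrow> 'a \<Rightarrow> bool) \<Rightarrow> 'a set \<Rightarrow> bool" where
  "order_convex_in A lt C \<longleftrightarrow>
     C \<subseteq> A \<and> (\<forall>x\<in>C. \<forall>y\<in>C. \<forall>z\<in>A. lt x z \<longrightarrow> lt z y \<longrightarrow> z \<in> C)"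

lemma openin_ray_topology:
  "openin (ray_topology A lt) =
     arbitrary union_of (finite intersection_of (\<lambda>S. S \<in> open_rays A lt) relative_to A)"
  unfolding ray_topology_def by (rule topology_inverse'[OF istopology_subbase])

lemma open_rays_subset: "R \<in> open_rays A lt \<Longrightarrow> R \<subseteq> A"
  unfolding open_rays_def by auto

lemma openin_ray_topology_ray:
  assumes "R \<in> open_rays A lt"
  shows "openin (ray_topology A lt) R"
proof -
  have "(finite intersection_of (\<lambda>S. S \<in> open_rays A lt) relative_to A) (A \<inter> R)"
    using assms by (intro relative_to_inc finite_intersection_of_inc)
  moreover have "A \<inter> R = R"
    using open_rays_subset[OF assms] by blast
  ultimately show ?thesis
    unfolding openin_ray_topology by (auto intro: arbitrary_union_of_inc)
qed

lemma openin_of_openin_ray_topology: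
  assumes "\<And>R. R \<in> open_rays (topspace X) lt \<Longrightarrow> openin X R"
    and "openin (ray_topology (topspace X) lt) U"
  shows "openin X U"
proof -
  have "openin X V"
    if V: "(finite intersection_of (\<lambda>S. S \<in> open_rays (topspace X) lt) relative_to topspace X) V"
    for V
  proof -
    obtain F where F: "finite F" "F \<subseteq> open_rays (topspace X) lt" "V = topspace X \<inter> \<Inter>F"
      using V unfolding relative_to_def intersection_of_def by auto
    have "openin X (topspace X \<inter> \<Inter>F)"
      using F(1,2) by (induction F rule: finite_induct) (auto simp: Int_left_commute intro: assms(1))
    then show ?thesis using F(3) by simp
  qed
  then show ?thesis
    using assms(2) unfolding openin_ray_topology union_of_def by auto
qed

text \<open>Open rays are convex by transitivity, and convexity survives the finite intersections that
  form the canonical base.\<close>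

lemma ray_topology_convex_nbhd:
  assumes lin: "strict_linear_on A lt"
    and U: "openin (ray_topology A lt) U" "x \<in> U"
  shows "\<exists>C. openin (ray_topology A lt) C \<and> order_convex_in A lt C \<and> x \<in> C \<and> C \<subseteq> U"
proof -
  obtain V where V: "(finite intersection_of (\<lambda>S. S \<in> open_rays A lt) relative_to A) V"
      "x \<in> V" "V \<subseteq> U"
    using U unfolding openin_ray_topology union_of_def by auto
  obtain F where F: "F \<subseteq> open_rays A lt" "V = A \<inter> \<Inter>F"
    using V(1) unfolding relative_to_def intersection_of_def by auto
  have trans: "lt a c" if "a \<in> A" "b \<in> A" "c \<in> A" "lt a b" "lt b c" for a b c
    using strict_linear_on_trans[OF lin] that by metis
  have ray: "order_convex_in A lt R" if "R \<in> open_rays A lt" for R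
    using that unfolding open_rays_def order_convex_in_def by (auto intro: trans)
  have "order_convex_in A lt V"
    unfolding order_convex_in_def
  proof (intro conjI ballI impI)
    show "V \<subseteq> A" using F(2) by blast
  next
    fix a b z assume "a \<in> V" "b \<in> V" "z \<in> A" "lt a z" "lt z b"
    moreover have "z \<in> R" if "R \<in> F" for R
      using ray[of R] that F calculation unfolding order_convex_in_def by blast
    ultimately show "z \<in> V" using F(2) by blast
  qed
  moreover have "openin (ray_topology A lt) V"
    unfolding openin_ray_topology using V(1) by (rule arbitrary_union_of_inc)
  ultimately show ?thesis using V by blast
qed

section \<open>Orders on suborderable spaces\<close>

text \<open>The order of a generalized ordered space, the intrinsic description of suborderability due
  to Cech.\<close>

definition go_order :: "'a topology \<Rightarrow> ('a \<Rightarrow> 'a \<Rightarrow> bool) \<Rightarrow> bool" where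
  "go_order X lt \<longleftrightarrow>
     strict_linear_on (topspace X) lt \<and>
     (\<forall>R \<in> open_rays (topspace X) lt. openin X R) \<and>
     (\<forall>U x. openin X U \<and> x \<in> U \<longrightarrow>
        (\<exists>C. openin X C \<and> order_convex_in (topspace X) lt C \<and> x \<in> C \<and> C \<subseteq> U))"

lemma go_order_linear: "go_order X lt \<Longrightarrow> strict_linear_on (topspace X) lt"
  unfolding go_order_def by (rule conjunct1)

lemma go_order_openin_rays:
  "go_order X lt \<Longrightarrow> R \<in> open_rays (topspace X) lt \<Longrightarrow> openin X R"
  unfolding go_order_def by simp

lemma go_order_convex_nbhd:
  assumes "go_order X lt" "openin X U" "x \<in> U"
  obtains C where "openin X C" "order_convex_in (topspace X) lt C" "x \<in> C" "C \<subseteq> U"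
proof -
  have "\<exists>C. openin X C \<and> order_convex_in (topspace X) lt C \<and> x \<in> C \<and> C \<subseteq> U"
    using assms unfolding go_order_def by blast
  then show ?thesis using that by auto
qed

lemma go_order_converse:
  assumes "go_order X lt"
  shows "go_order X (\<lambda>x y. lt y x)"
proof -
  have "open_rays (topspace X) (\<lambda>x y. lt y x) = open_rays (topspace X) lt"
    unfolding open_rays_def by auto
  moreover have "order_convex_in (topspace X) (\<lambda>x y. lt y x) = order_convex_in (topspace X) lt"
    unfolding order_convex_in_def by (intro ext) blast
  moreover have "strict_linear_on (topspace X) (\<lambda>x y. lt y x)"
    using go_order_linear[OF assms] by (rule strict_linear_on_converse)
  ultimately show ?thesis
    using assms unfolding go_order_def by metis
qed

text \<open>The order is pulled back along an embedding into an orderable space: preimages of rays are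
  open by continuity, and preimages of convex sets are convex.\<close>

lemma suborderable_imp_go_order:
  fixes X :: "'a topology"
  assumes "suborderable_space TYPE('b) X"
  shows "\<exists>lt. go_order X lt"
proof -
  obtain Y :: "'b topology" and S r f
    where lin: "linear_order_on (topspace Y) r"
      and Y: "Y = open_interval_topology (topspace Y) r"
      and S: "S \<subseteq> topspace Y"
      and f: "homeomorphic_map X (subtopology Y S) f"
    using assms unfolding suborderable_space_def orderable_space_def homeomorphic_space by blast
  define lt' where "lt' \<equiv> \<lambda>x y. (x, y) \<in> r \<and> x \<noteq> y"
  define lt where "lt \<equiv> \<lambda>x y. lt' (f x) (f y)"
  let ?X = "topspace X" and ?Y = "topspace Y"
  have Y': "Y = ray_topology ?Y lt'"
    using Y unfolding open_interval_topology_def lt'_def .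
  have lin': "strict_linear_on ?Y lt'"
    unfolding strict_linear_on_def
  proof (intro conjI ballI impI)
    fix x y z assume "lt' x y" "lt' y z"
    then show "lt' x z"
      using lin unfolding linear_order_on_def partial_order_on_def preorder_on_def lt'_def
      by (metis antisymD transD)
  qed (use lin in \<open>auto simp: linear_order_on_def total_on_def lt'_def\<close>)
  have inj: "inj_on f ?X"
    using f by (simp add: homeomorphic_imp_injective_map)
  have img: "f ` ?X = S"
    using homeomorphic_imp_surjective_map[OF f] S by auto
  then have fY: "f x \<in> ?Y" if "x \<in> ?X" for x
    using that S by blast
  have cont: "continuous_map X Y f"
    using homeomorphic_imp_continuous_map[OF f] continuous_map_in_subtopology by blast
  have preimage: "openin X {x \<in> ?X. f x \<in> C}" if "openin Y C" for C
    using cont that by (rule openin_continuous_map_preimage)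
  have "strict_linear_on ?X lt"
    unfolding strict_linear_on_def
  proof (intro conjI ballI impI)
    fix x assume "x \<in> ?X"
    then show "\<not> lt x x"
      using strict_linear_on_irrefl[OF lin'] fY unfolding lt_def by simp
  next
    fix x y z assume "x \<in> ?X" "y \<in> ?X" "z \<in> ?X" "lt x y" "lt y z"
    then show "lt x z"
      using strict_linear_on_trans[OF lin' fY fY fY] unfolding lt_def by metis
  next
    fix x y assume "x \<in> ?X" "y \<in> ?X" "x \<noteq> y"
    moreover from this have "f x \<noteq> f y" using inj unfolding inj_on_def by blast
    ultimately show "lt x y \<or> lt y x"
      using strict_linear_on_total[OF lin' fY fY] unfolding lt_def by simp
  qed
  moreover have "openin X R" if R: "R \<in> open_rays ?X lt" for R
  proof -
    obtain x where x: "x \<in> ?X" and "R = {y \<in> ?X. lt y x} \<or> R = {y \<in> ?X. lt x y}"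
      using R unfolding open_rays_def by auto
    then have eq: "R = {y \<in> ?X. f y \<in> {z \<in> ?Y. lt' z (f x)}} \<or>
        R = {y \<in> ?X. f y \<in> {z \<in> ?Y. lt' (f x) z}}"
      using fY unfolding lt_def by auto
    have "openin Y T" if "T \<in> open_rays ?Y lt'" for T
      using openin_ray_topology_ray[OF that] Y' by simp
    then have rays: "openin Y {z \<in> ?Y. lt' z (f x)}" "openin Y {z \<in> ?Y. lt' (f x) z}"
      using fY[OF x] unfolding open_rays_def by auto
    show ?thesis
      using eq preimage[OF rays(1)] preimage[OF rays(2)] by (elim disjE) (simp_all only:)
  qed
  moreover have "\<exists>C. openin X C \<and> order_convex_in ?X lt C \<and> x \<in> C \<and> C \<subseteq> U"
    if U: "openin X U" "x \<in> U" for U x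
  proof -
    have sub: "U \<subseteq> ?X" using U(1) by (rule openin_subset)
    have "openin (subtopology Y S) (f ` U)"
      using homeomorphic_imp_open_map[OF f] U(1) unfolding open_map_def by blast
    then obtain W where W: "openin Y W" "f ` U = W \<inter> S"
      unfolding openin_subtopology by blast
    obtain C where C: "openin Y C" "order_convex_in ?Y lt' C" "f x \<in> C" "C \<subseteq> W"
      using ray_topology_convex_nbhd[OF lin', of W "f x"] W U(2) Y' by auto
    let ?C = "{y \<in> ?X. f y \<in> C}"
    have "order_convex_in ?X lt ?C"
      using C(2) fY unfolding order_convex_in_def lt_def by blast
    moreover have "?C \<subseteq> U"
    proof
      fix y assume y: "y \<in> ?C"
      then have "f y \<in> f ` U" using C(4) W(2) img by blast
      then show "y \<in> U" using y inj sub unfolding inj_on_def by blast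
    qed
    ultimately show ?thesis using preimage[OF C(1)] C(3) U(2) sub by blast
  qed
  ultimately show ?thesis unfolding go_order_def by blast
qed

section \<open>Gaps and compactness\<close>

text \<open>This is the argument that a closed real interval is compact. Given an open cover, let \<open>A\<close> be
  the set of points \<open>x\<close> such that finitely many members cover everything up to \<open>x\<close>. One convex
  neighbourhood inside a member of the cover decides membership in \<open>A\<close> for all its points
  simultaneously, hence \<open>A\<close> is a clopen initial segment. Its last point shows that \<open>A\<close> itself is
  finitely covered, and one more member would cover the first point of the complement.\<close>

lemma compact_if_no_gaps:
  assumes go: "go_order X lt"
    and last: "\<And>A. \<lbrakk>openin X A; closedin X A; A \<noteq> {};
        \<And>x y. \<lbrakk>y \<in> A; x \<in> topspace X; lt x y\<rbrakk> \<Longrightarrow> x \<in> A\<rbrakk> \<Longrightarrow> \<exists>m\<in>A. \<forall>x\<in>A. \<not> lt m x"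
    and first: "\<And>B. \<lbrakk>openin X B; closedin X B; B \<noteq> {};
        \<And>x y. \<lbrakk>x \<in> B; y \<in> topspace X; lt x y\<rbrakk> \<Longrightarrow> y \<in> B\<rbrakk> \<Longrightarrow> \<exists>m\<in>B. \<forall>x\<in>B. \<not> lt x m"
  shows "compact_space X"
  unfolding compact_space
proof (intro allI impI)
  fix \<U> assume "(\<forall>U\<in>\<U>. openin X U) \<and> \<Union>\<U> = topspace X"
  then have op: "\<And>U. U \<in> \<U> \<Longrightarrow> openin X U" and cov: "\<Union>\<U> = topspace X" by auto
  let ?X = "topspace X"
  define fin_covered where "fin_covered \<equiv> \<lambda>T. \<exists>\<F>. finite \<F> \<and> \<F> \<subseteq> \<U> \<and> T \<subseteq> \<Union>\<F>"
  have fin_covered_Un: "fin_covered T" if T: "fin_covered T1" "U \<in> \<U>" "T \<subseteq> T1 \<union> U" for T T1 U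
  proof -
    obtain \<F> where "finite \<F>" "\<F> \<subseteq> \<U>" "T1 \<subseteq> \<Union>\<F>"
      using T(1) unfolding fin_covered_def by blast
    then show ?thesis
      unfolding fin_covered_def using T(2,3) by (intro exI[of _ "insert U \<F>"]) auto
  qed
  have fin_covered_subset: "fin_covered T" if "fin_covered T1" "T \<subseteq> T1" for T T1
    using that unfolding fin_covered_def by (meson order_trans)
  have fin_covered_empty: "fin_covered {}" unfolding fin_covered_def by (intro exI[of _ "{}"]) simp
  have lin: "strict_linear_on ?X lt"
    using go by (rule go_order_linear)
  note trans = strict_linear_on_trans[OF lin]
  have total: "x = y \<or> lt x y \<or> lt y x" if "x \<in> ?X" "y \<in> ?X" for x y
    using strict_linear_on_total[OF lin that] by blast
  define up_to where "up_to \<equiv> \<lambda>x. {y \<in> ?X. \<not> lt x y}"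
  define A where "A = {x \<in> ?X. fin_covered (up_to x)}"
  have AX: "A \<subseteq> ?X" unfolding A_def by blast
  have down: "x \<in> A" if "y \<in> A" "x \<in> ?X" "lt x y" for x y
  proof -
    have "up_to x \<subseteq> up_to y"
      using that AX trans[of x y] unfolding up_to_def by blast
    then show ?thesis using that fin_covered_subset unfolding A_def by blast
  qed
  have nbhd: "\<exists>C. openin X C \<and> x \<in> C \<and> (\<forall>y\<in>C. \<forall>z\<in>C. y \<in> A \<longrightarrow> z \<in> A)" if x: "x \<in> ?X" for x
  proof -
    obtain U where U: "U \<in> \<U>" "x \<in> U" using cov x by blast
    obtain C where C: "openin X C" "order_convex_in ?X lt C" "x \<in> C" "C \<subseteq> U"
      using go_order_convex_nbhd[OF go op[OF U(1)] U(2)] .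
    have "z \<in> A" if yz: "y \<in> C" "z \<in> C" "y \<in> A" for y z
    proof -
      have X: "y \<in> ?X" "z \<in> ?X" using yz C(1) openin_subset by blast+
      \<comment> \<open>By convexity, whatever lies below \<open>z\<close> but not up to \<open>y\<close> is in \<open>C\<close>, so in the one set \<open>U\<close>.\<close>
      have "up_to z \<subseteq> up_to y \<union> C"
      proof
        fix w assume w: "w \<in> up_to z"
        then have wX: "w \<in> ?X" and "w = z \<or> lt w z"
          using total X unfolding up_to_def by blast+
        then show "w \<in> up_to y \<union> C"
          using yz C(2) unfolding up_to_def order_convex_in_def by blast
      qed
      then show ?thesis
        using fin_covered_Un[of "up_to y" U "up_to z"] yz X U C(4) unfolding A_def by blast
    qed
    then show ?thesis using C by blast
  qed
  have opA: "openin X A"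
  proof (subst openin_subopen, intro ballI)
    fix x assume x: "x \<in> A"
    then obtain C where "openin X C" "x \<in> C" "\<forall>y\<in>C. \<forall>z\<in>C. y \<in> A \<longrightarrow> z \<in> A"
      using nbhd[of x] AX by auto
    then show "\<exists>T. openin X T \<and> x \<in> T \<and> T \<subseteq> A"
      using x by auto
  qed
  have opB: "openin X (?X - A)"
  proof (subst openin_subopen, intro ballI)
    fix x assume x: "x \<in> ?X - A"
    then obtain C where "openin X C" "x \<in> C" "\<forall>y\<in>C. \<forall>z\<in>C. y \<in> A \<longrightarrow> z \<in> A"
      using nbhd[of x] by auto
    then show "\<exists>T. openin X T \<and> x \<in> T \<and> T \<subseteq> ?X - A"
      using x openin_subset[of X C] by blast
  qed
  have clA: "closedin X A" using AX opB unfolding closedin_def by blast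
  have covA: "fin_covered A"
  proof (cases "A = {}")
    case False
    then obtain m where m: "m \<in> A" "\<forall>x\<in>A. \<not> lt m x"
      using last[OF opA clA] down by blast
    then have "A \<subseteq> up_to m" using AX unfolding up_to_def by blast
    then show ?thesis using m(1) fin_covered_subset unfolding A_def by blast
  qed (use fin_covered_empty in simp)
  have "?X - A = {}"
  proof (rule ccontr)
    assume ne: "?X - A \<noteq> {}"
    have "closedin X (?X - A)" using opA by blast
    then obtain b where b: "b \<in> ?X - A" "\<forall>x \<in> ?X - A. \<not> lt x b"
      using first[OF opB _ ne] down by blast
    obtain U where U: "U \<in> \<U>" "b \<in> U" using cov b(1) by blast
    have "up_to b \<subseteq> A \<union> U"
      using b U(2) total unfolding up_to_def by blast
    then have "fin_covered (up_to b)" using fin_covered_Un[OF covA U(1)] by blast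
    then show False using b(1) unfolding A_def by blast
  qed
  then have "fin_covered ?X" using covA fin_covered_subset by blast
  then obtain \<F> where F: "finite \<F>" "\<F> \<subseteq> \<U>" "?X \<subseteq> \<Union>\<F>" unfolding fin_covered_def by blast
  then have "\<Union>\<F> = ?X" using cov by blast
  then show "\<exists>\<F>. finite \<F> \<and> \<F> \<subseteq> \<U> \<and> \<Union>\<F> = ?X" using F by blast
qed

section \<open>Choosing the smaller point\<close>

definition min_selection :: "('a \<Rightarrow> 'a \<Rightarrow> bool) \<Rightarrow> 'a set \<Rightarrow> 'a" where
  "min_selection lt S = (SOME x. x \<in> S \<and> (\<forall>y\<in>S. \<not> lt y x))"

lemma min_selection_pair:
  assumes "strict_linear_on A lt" "x \<in> A" "y \<in> A"
  shows "min_selection lt {x, y} = (if lt y x then y else x)"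
  unfolding min_selection_def
  using strict_linear_on_irrefl[OF assms(1)] strict_linear_on_trans[OF assms(1,2,3,2)]
    strict_linear_on_total[OF assms] assms(2,3)
  by (intro some_equality) (auto split: if_splits)

lemma min_selection_less:
  assumes "strict_linear_on A lt" "x \<in> A" "y \<in> A"
  shows "sel_less (min_selection lt) x y \<longleftrightarrow> lt x y"
  using strict_linear_on_irrefl[OF assms(1)] strict_linear_on_trans[OF assms(1,2,3,2)]
    strict_linear_on_total[OF assms] assms(2,3)
  unfolding sel_less_def sel_le_def min_selection_pair[OF assms] by auto

lemma F2_cases:
  assumes "S \<in> F2 A"
  obtains x y where "x \<in> A" "y \<in> A" "S = {x, y}"
proof -
  have "card S = 1 \<or> card S = 2" "S \<subseteq> A"
    using assms unfolding F2_def by auto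
  then show ?thesis
    using that by (auto simp: card_1_singleton_iff card_2_iff)
qed

lemma min_selection_separately_continuous:
  assumes lin: "strict_linear_on (topspace X) lt"
    and rays: "\<And>R. R \<in> open_rays (topspace X) lt \<Longrightarrow> openin X R"
  shows "separately_continuous_selection X (min_selection lt)"
proof -
  have "weak_selection (topspace X) (min_selection lt)"
    unfolding weak_selection_def
    by (auto elim!: F2_cases simp: min_selection_pair[OF lin])
  moreover have "open_rays (topspace X) (sel_less (min_selection lt)) = open_rays (topspace X) lt"
    unfolding open_rays_def using min_selection_less[OF lin]
    by (intro SUP_cong refl) (auto simp: set_eq_iff cong: conj_cong)
  ultimately show ?thesis
    unfolding separately_continuous_selection_def selection_topology_def
    using openin_of_openin_ray_topology[of X "sel_less (min_selection lt)"] rays by auto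
qed

text \<open>For a minimum selection, a chain leading up to \<open>q\<close> collapses by transitivity: its first
  element cannot lie above \<open>q\<close>.\<close>

lemma quasi_sel_king_min_selection_last:
  assumes lin: "strict_linear_on A lt"
    and king: "quasi_sel_king A (min_selection lt) q"
    and "x \<in> A"
  shows "\<not> lt q x"
proof -
  have le: "sel_le (min_selection lt) a b \<longleftrightarrow> \<not> lt b a" if "a \<in> A" "b \<in> A" for a b
    using strict_linear_on_irrefl[OF lin] that
    unfolding sel_le_def min_selection_pair[OF lin that] by auto
  have q: "q \<in> A" using king unfolding quasi_sel_king_def by blast
  have chain: "\<not> lt q a"
    if "successively (sel_le (min_selection lt)) (a # ys @ [q])" "a \<in> A" "set ys \<subseteq> A" for a ys
    using that
  proof (induction ys arbitrary: a)
    case Nil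
    then show ?case using le q by simp
  next
    case (Cons b ys)
    then have "\<not> lt b a" "\<not> lt q b" using le by auto
    then show ?case
      using strict_linear_on_trans[OF lin q, of a b] strict_linear_on_total[OF lin, of a b]
        q Cons.prems by auto
  qed
  then show ?thesis
    using king \<open>x \<in> A\<close> unfolding quasi_sel_king_def by blast
qed

lemma quasi_king_space_has_last:
  assumes "quasi_king_space X"
    and lin: "strict_linear_on (topspace X) lt"
    and rays: "\<And>R. R \<in> open_rays (topspace X) lt \<Longrightarrow> openin X R"
  shows "\<exists>q \<in> topspace X. \<forall>x \<in> topspace X. \<not> lt q x"
proof -
  obtain q where q: "quasi_sel_king (topspace X) (min_selection lt) q"
    using assms(1) min_selection_separately_continuous[OF lin rays]
    unfolding quasi_king_space_def by blast
  then show ?thesis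
    using quasi_sel_king_min_selection_last[OF lin q] unfolding quasi_sel_king_def by blast
qed

section \<open>Moving a clopen set to the top\<close>

text \<open>Apply the existence of a last point to the rearranged order. That order, in which
  the complement of \<open>A\<close> lies below \<open>A\<close>, again has open rays, because each of its rays is a ray of
  the given order cut down to one of the clopen pieces, possibly together with the other piece.
  Its last point lies in the upper piece \<open>A\<close>, which is nonempty.\<close>

lemma quasi_king_clopen_has_last:
  assumes qk: "quasi_king_space X" and go: "go_order X lt"
    and A: "openin X A" "closedin X A" "A \<noteq> {}"
  shows "\<exists>m\<in>A. \<forall>x\<in>A. \<not> lt m x"
proof -
  let ?X = "topspace X"
  define lt' where "lt' \<equiv> \<lambda>x y. if x \<in> A \<longleftrightarrow> y \<in> A then lt x y else y \<in> A"
  have AX: "A \<subseteq> ?X" using A(1) by (rule openin_subset)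
  have opB: "openin X (?X - A)" using A(2) by blast
  have lin: "strict_linear_on ?X lt" using go by (rule go_order_linear)
  have lin': "strict_linear_on ?X lt'"
    unfolding strict_linear_on_def
  proof (intro conjI ballI impI)
    fix x assume "x \<in> ?X"
    then show "\<not> lt' x x"
      using strict_linear_on_irrefl[OF lin] unfolding lt'_def by simp
  next
    fix x y z assume xyz: "x \<in> ?X" "y \<in> ?X" "z \<in> ?X" "lt' x y" "lt' y z"
    have "lt x z" if "lt x y" "lt y z"
      using strict_linear_on_trans[OF lin xyz(1-3) that] .
    then show "lt' x z"
      using xyz(4,5) unfolding lt'_def by (auto split: if_splits)
  next
    fix x y assume "x \<in> ?X" "y \<in> ?X" "x \<noteq> y"
    then have "lt x y \<or> lt y x" by (rule strict_linear_on_total[OF lin])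
    then show "lt' x y \<or> lt' y x" unfolding lt'_def by auto
  qed
  have "openin X R" if R: "R \<in> open_rays ?X lt'" for R
  proof -
    obtain x where x: "x \<in> ?X" and R': "R = {y \<in> ?X. lt' y x} \<or> R = {y \<in> ?X. lt' x y}"
      using R unfolding open_rays_def by auto
    have op: "openin X {y \<in> ?X. lt y x}" "openin X {y \<in> ?X. lt x y}"
      using go_order_openin_rays[OF go] x unfolding open_rays_def by auto
    show ?thesis
    proof (cases "x \<in> A")
      case True
      then have "R = {y \<in> ?X. lt y x} \<inter> A \<union> (?X - A) \<or> R = {y \<in> ?X. lt x y} \<inter> A"
        using R' AX unfolding lt'_def by (auto split: if_splits)
      then show ?thesis using op A(1) opB by (elim disjE) (simp_all only: openin_Int openin_Un)
    next
      case False
      then have "R = {y \<in> ?X. lt y x} \<inter> (?X - A) \<or> R = {y \<in> ?X. lt x y} \<inter> (?X - A) \<union> A"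
        using R' AX unfolding lt'_def by (auto split: if_splits)
      then show ?thesis using op A(1) opB by (elim disjE) (simp_all only: openin_Int openin_Un)
    qed
  qed
  then obtain q where q: "q \<in> ?X" "\<forall>x \<in> ?X. \<not> lt' q x"
    using quasi_king_space_has_last[OF qk lin'] by blast
  have "q \<in> A" using q A(3) AX unfolding lt'_def by force
  moreover from this have "\<not> lt q x" if "x \<in> A" for x
    using bspec[OF q(2), of x] that AX unfolding lt'_def by auto
  ultimately show ?thesis by blast
qed

theorem proposition4p3:
  fixes X :: "'a topology"
  assumes "Hausdorff_space X"
    and "suborderable_space TYPE('b) X"
    and "quasi_king_space X"
  shows "compact_space X"
proof -
  obtain lt where go: "go_order X lt"
    using suborderable_imp_go_order[OF assms(2)] by blast
  show ?thesis
    using go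
  proof (rule compact_if_no_gaps)
    fix A assume "openin X A" "closedin X A" "A \<noteq> {}"
    then show "\<exists>m\<in>A. \<forall>x\<in>A. \<not> lt m x"
      by (rule quasi_king_clopen_has_last[OF assms(3) go])
  next
    fix B assume "openin X B" "closedin X B" "B \<noteq> {}"
    then show "\<exists>m\<in>B. \<forall>x\<in>B. \<not> lt x m"
      by (rule quasi_king_clopen_has_last[OF assms(3) go_order_converse[OF go]])
  qed
qed

end
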